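(* Let $r$ be a square root on an EMV-algebra $(M;\vee,\wedge,\oplus,0)$. Then $M$ is a generalized Boolean algebra if and only if $r(0)=0$. In addition, the restriction of $r$ to the generalized Boolean algebra $\mathcal I(M)$ of idempotents is a square root on $\mathcal I(M)$ if and only if $r(0)=0$.
   Context: An EMV-algebra is an algebra $(M;\vee,\wedge,\oplus,0)$ of type $(2,2,2,0)$ such that: (E1) $(M;\vee,\wedge,0)$ is a distributive lattice with least element $0$; (E2) $(M;\oplus,0)$ is a commutative ordered monoid with neutral element $0$; (E3) writing $\mathcal I(M)=\{x\in M\mid x\oplus x=x\}$ (the idempotents), for each $a\in\mathcal I(M)$ and each $x\in[0,a]$ the element $\lambda_a(x)=\min\{z\in[0,a]\mid x\oplus z=a\}$ exists, and $([0,a];\oplus,\lambda_a,0,a)$ is an MV-algebra; (E4) for each $x\in M$ there is $a\in\mathcal I(M)$ with $x\le a$. A top element is not assumed. For $x,y\in M$, $x\odot y:=\lambda_a(\lambda_a(x)\oplus\lambda_a(y))$ for any $a\in\mathcal I(M)$ with $x,y\le a$ (this does not depend on $a$). A generalized Boolean algebra is a relatively complemented distributive lattice with bottom element; it is regarded as an EMV-algebra with $\oplus=\vee$ (so $\odot=\wedge$), and an EMV-algebra is a generalized Boolean algebra when $\oplus=\vee$. A square root on $M$ is a map $s:M\to M$ such that (Sq1) $s(x)\odot s(x)=x$ for all $x\in M$; (Sq2) for all $x,y\in M$, $y\odot y\le x$ implies $y\le s(x)$. *)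

theory Defs
  imports "HOL-Algebra.Group"
begin

section \<open>Generalized Boolean algebras and EMV-algebras\<close>

record 'a emv = "'a partial_object" +
  vee :: "'a \<Rightarrow> 'a \<Rightarrow> 'a" (infixl "\<curlyvee>\<index>" 65)
  wedge :: "'a \<Rightarrow> 'a \<Rightarrow> 'a" (infixl "\<curlywedge>\<index>" 70)
  oplus :: "'a \<Rightarrow> 'a \<Rightarrow> 'a" (infixl "\<oplus>\<index>" 65)
  zero :: 'a ("\<zero>\<index>")

definition emv_le :: "('a, 'm) emv_scheme \<Rightarrow> 'a \<Rightarrow> 'a \<Rightarrow> bool" (infix "\<preceq>\<index>" 50)
  where "x \<preceq>\<^bsub>M\<^esub> y \<longleftrightarrow> x \<curlywedge>\<^bsub>M\<^esub> y = x"

locale distrib_lattice_zero =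
  fixes M :: "('a, 'm) emv_scheme" (structure)
  assumes zero_closed: "\<zero> \<in> carrier M"
    and vee_closed: "\<lbrakk>x \<in> carrier M; y \<in> carrier M\<rbrakk> \<Longrightarrow> x \<curlyvee> y \<in> carrier M"
    and wedge_closed: "\<lbrakk>x \<in> carrier M; y \<in> carrier M\<rbrakk> \<Longrightarrow> x \<curlywedge> y \<in> carrier M"
    and vee_assoc: "\<lbrakk>x \<in> carrier M; y \<in> carrier M; z \<in> carrier M\<rbrakk>
          \<Longrightarrow> (x \<curlyvee> y) \<curlyvee> z = x \<curlyvee> (y \<curlyvee> z)"
    and wedge_assoc: "\<lbrakk>x \<in> carrier M; y \<in> carrier M; z \<in> carrier M\<rbrakk>
          \<Longrightarrow> (x \<curlywedge> y) \<curlywedge> z = x \<curlywedge> (y \<curlywedge> z)"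
    and vee_comm: "\<lbrakk>x \<in> carrier M; y \<in> carrier M\<rbrakk> \<Longrightarrow> x \<curlyvee> y = y \<curlyvee> x"
    and wedge_comm: "\<lbrakk>x \<in> carrier M; y \<in> carrier M\<rbrakk> \<Longrightarrow> x \<curlywedge> y = y \<curlywedge> x"
    and vee_absorb: "\<lbrakk>x \<in> carrier M; y \<in> carrier M\<rbrakk> \<Longrightarrow> x \<curlyvee> (x \<curlywedge> y) = x"
    and wedge_absorb: "\<lbrakk>x \<in> carrier M; y \<in> carrier M\<rbrakk> \<Longrightarrow> x \<curlywedge> (x \<curlyvee> y) = x"
    and wedge_vee_distrib: "\<lbrakk>x \<in> carrier M; y \<in> carrier M; z \<in> carrier M\<rbrakk>
          \<Longrightarrow> x \<curlywedge> (y \<curlyvee> z) = (x \<curlywedge> y) \<curlyvee> (x \<curlywedge> z)"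
    and zero_le: "x \<in> carrier M \<Longrightarrow> \<zero> \<preceq> x"

locale gen_boolean_lattice = distrib_lattice_zero +
  assumes rel_complemented:
    "\<lbrakk>a \<in> carrier M; b \<in> carrier M; x \<in> carrier M; a \<preceq> x; x \<preceq> b\<rbrakk>
      \<Longrightarrow> \<exists>y\<in>carrier M. x \<curlywedge> y = a \<and> x \<curlyvee> y = b"

locale mv_algebra =
  fixes A :: "'a set" and add :: "'a \<Rightarrow> 'a \<Rightarrow> 'a" and neg :: "'a \<Rightarrow> 'a" and null unit :: 'a
  assumes comm_monoid: "comm_monoid \<lparr>carrier = A, mult = add, one = null\<rparr>"
    and unit_closed: "unit \<in> A"
    and neg_closed: "x \<in> A \<Longrightarrow> neg x \<in> A"
    and neg_null: "neg null = unit"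
    and neg_neg: "x \<in> A \<Longrightarrow> neg (neg x) = x"
    and add_unit: "x \<in> A \<Longrightarrow> add x unit = unit"
    and lukasiewicz: "\<lbrakk>x \<in> A; y \<in> A\<rbrakk>
          \<Longrightarrow> add x (neg (add x (neg y))) = add y (neg (add y (neg x)))"

definition idempotents :: "('a, 'm) emv_scheme \<Rightarrow> 'a set"
  where "idempotents M = {x \<in> carrier M. x \<oplus>\<^bsub>M\<^esub> x = x}"

definition initial_segment :: "('a, 'm) emv_scheme \<Rightarrow> 'a \<Rightarrow> 'a set"
  where "initial_segment M a = {x \<in> carrier M. x \<preceq>\<^bsub>M\<^esub> a}"

definition is_min :: "('a, 'm) emv_scheme \<Rightarrow> 'a \<Rightarrow> 'a set \<Rightarrow> bool"
  where "is_min M z S \<longleftrightarrow> z \<in> S \<and> (\<forall>w\<in>S. z \<preceq>\<^bsub>M\<^esub> w)"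

definition emv_neg :: "('a, 'm) emv_scheme \<Rightarrow> 'a \<Rightarrow> 'a \<Rightarrow> 'a"
  where "emv_neg M a x =
    (THE z. is_min M z {z \<in> initial_segment M a. x \<oplus>\<^bsub>M\<^esub> z = a})"

locale emv_algebra = distrib_lattice_zero +
  assumes oplus_comm_monoid: "comm_monoid \<lparr>carrier = carrier M, mult = oplus M, one = \<zero>\<rparr>"
    and oplus_mono: "\<lbrakk>x \<in> carrier M; y \<in> carrier M; z \<in> carrier M; x \<preceq> y\<rbrakk>
          \<Longrightarrow> x \<oplus> z \<preceq> y \<oplus> z"
    and neg_exists: "\<lbrakk>a \<in> idempotents M; x \<in> initial_segment M a\<rbrakk>
          \<Longrightarrow> \<exists>z. is_min M z {z \<in> initial_segment M a. x \<oplus> z = a}"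
    and segment_mv: "a \<in> idempotents M
          \<Longrightarrow> mv_algebra (initial_segment M a) (oplus M) (emv_neg M a) \<zero> a"
    and idempotent_above: "x \<in> carrier M \<Longrightarrow> \<exists>a\<in>idempotents M. x \<preceq> a"

definition emv_odot_at :: "('a, 'm) emv_scheme \<Rightarrow> 'a \<Rightarrow> 'a \<Rightarrow> 'a \<Rightarrow> 'a"
  where "emv_odot_at M a x y = emv_neg M a (emv_neg M a x \<oplus>\<^bsub>M\<^esub> emv_neg M a y)"

text \<open>The choice of the bounding idempotent does not matter: see \<open>emv_odot_eq\<close> below.\<close>

definition emv_odot :: "('a, 'm) emv_scheme \<Rightarrow> 'a \<Rightarrow> 'a \<Rightarrow> 'a" (infixl "\<odot>\<index>" 70)
  where "x \<odot>\<^bsub>M\<^esub> y =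
    emv_odot_at M (SOME a. a \<in> idempotents M \<and> x \<preceq>\<^bsub>M\<^esub> a \<and> y \<preceq>\<^bsub>M\<^esub> a) x y"

text \<open>A generalized Boolean algebra is regarded as an EMV-algebra through \<open>\<oplus> = \<or>\<close>. For an
  EMV-algebra this equation alone already makes the lattice relatively complemented:
  see \<open>is_generalized_boolean_iff\<close> below.\<close>

definition is_generalized_boolean :: "('a, 'm) emv_scheme \<Rightarrow> bool"
  where "is_generalized_boolean M \<longleftrightarrow>
    gen_boolean_lattice M \<and> (\<forall>x\<in>carrier M. \<forall>y\<in>carrier M. x \<oplus>\<^bsub>M\<^esub> y = x \<curlyvee>\<^bsub>M\<^esub> y)"

text \<open>The idempotents with the inherited operations. On them \<open>\<oplus>\<close> coincides with \<open>\<or>\<close>: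
  see \<open>idempotent_algebra_generalized_boolean\<close> below.\<close>

definition idempotent_algebra :: "('a, 'm) emv_scheme \<Rightarrow> ('a, 'm) emv_scheme"
  where "idempotent_algebra M = M\<lparr>carrier := idempotents M\<rparr>"

definition square_root :: "('a, 'm) emv_scheme \<Rightarrow> ('a \<Rightarrow> 'a) \<Rightarrow> bool"
  where "square_root M s \<longleftrightarrow>
    s \<in> carrier M \<rightarrow> carrier M \<and>
    (\<forall>x\<in>carrier M. s x \<odot>\<^bsub>M\<^esub> s x = x) \<and>
    (\<forall>x\<in>carrier M. \<forall>y\<in>carrier M. y \<odot>\<^bsub>M\<^esub> y \<preceq>\<^bsub>M\<^esub> x \<longrightarrow> y \<preceq>\<^bsub>M\<^esub> s x)"


section \<open>The conventions are well posed\<close>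

context distrib_lattice_zero
begin

lemma le_refl: "x \<in> carrier M \<Longrightarrow> x \<preceq> x"
  unfolding emv_le_def by (metis vee_absorb wedge_absorb wedge_closed)

lemma le_trans:
  "\<lbrakk>x \<in> carrier M; y \<in> carrier M; z \<in> carrier M; x \<preceq> y; y \<preceq> z\<rbrakk> \<Longrightarrow> x \<preceq> z"
  unfolding emv_le_def by (metis wedge_assoc)

lemma le_antisym: "\<lbrakk>x \<in> carrier M; y \<in> carrier M; x \<preceq> y; y \<preceq> x\<rbrakk> \<Longrightarrow> x = y"
  unfolding emv_le_def by (metis wedge_comm)

lemma le_vee1: "\<lbrakk>x \<in> carrier M; y \<in> carrier M\<rbrakk> \<Longrightarrow> x \<preceq> x \<curlyvee> y"
  unfolding emv_le_def by (rule wedge_absorb)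

lemma le_vee2: "\<lbrakk>x \<in> carrier M; y \<in> carrier M\<rbrakk> \<Longrightarrow> y \<preceq> x \<curlyvee> y"
  using le_vee1 vee_comm by metis

lemma vee_least:
  "\<lbrakk>x \<in> carrier M; y \<in> carrier M; z \<in> carrier M; x \<preceq> z; y \<preceq> z\<rbrakk> \<Longrightarrow> x \<curlyvee> y \<preceq> z"
  unfolding emv_le_def by (metis vee_closed wedge_comm wedge_vee_distrib)

lemma wedge_le1: "\<lbrakk>x \<in> carrier M; y \<in> carrier M\<rbrakk> \<Longrightarrow> x \<curlywedge> y \<preceq> x"
  unfolding emv_le_def by (metis le_refl emv_le_def wedge_assoc wedge_comm wedge_closed)

lemma wedge_le2: "\<lbrakk>x \<in> carrier M; y \<in> carrier M\<rbrakk> \<Longrightarrow> x \<curlywedge> y \<preceq> y"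
  using wedge_le1 wedge_comm by metis

lemma wedge_greatest:
  "\<lbrakk>x \<in> carrier M; y \<in> carrier M; z \<in> carrier M; z \<preceq> x; z \<preceq> y\<rbrakk> \<Longrightarrow> z \<preceq> x \<curlywedge> y"
  unfolding emv_le_def by (metis wedge_assoc)

lemma vee_of_le: "\<lbrakk>x \<in> carrier M; y \<in> carrier M; x \<preceq> y\<rbrakk> \<Longrightarrow> x \<curlyvee> y = y"
  by (meson le_antisym le_refl le_vee2 vee_closed vee_least)

end

context emv_algebra
begin

sublocale plus: comm_monoid "\<lparr>carrier = carrier M, mult = oplus M, one = \<zero>\<rparr>"
  rewrites "carrier \<lparr>carrier = carrier M, mult = oplus M, one = \<zero>\<rparr> = carrier M"
    and "mult \<lparr>carrier = carrier M, mult = oplus M, one = \<zero>\<rparr> = oplus M"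
    and "one \<lparr>carrier = carrier M, mult = oplus M, one = \<zero>\<rparr> = \<zero>"
  by (simp_all add: oplus_comm_monoid)

lemmas oplus_closed = plus.m_closed

lemma oplus_mono2:
  assumes "x \<in> carrier M" "y \<in> carrier M" "u \<in> carrier M" "v \<in> carrier M" "x \<preceq> u" "y \<preceq> v"
  shows "x \<oplus> y \<preceq> u \<oplus> v"
proof -
  have "x \<oplus> y \<preceq> u \<oplus> y" "y \<oplus> u \<preceq> v \<oplus> u" using assms oplus_mono by auto
  moreover have "y \<oplus> u = u \<oplus> y" "v \<oplus> u = u \<oplus> v" using assms plus.m_comm by auto
  ultimately show ?thesis using le_trans[of "x \<oplus> y" "u \<oplus> y" "u \<oplus> v"] assms by simp
qed

lemma le_oplus1: "\<lbrakk>x \<in> carrier M; y \<in> carrier M\<rbrakk> \<Longrightarrow> x \<preceq> x \<oplus> y"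
  using oplus_mono2[of x \<zero> x y] by (simp add: le_refl zero_le zero_closed)

lemma le_oplus2: "\<lbrakk>x \<in> carrier M; y \<in> carrier M\<rbrakk> \<Longrightarrow> y \<preceq> x \<oplus> y"
  using le_oplus1[of y x] plus.m_comm by metis

lemma idemD: "a \<in> idempotents M \<Longrightarrow> a \<in> carrier M" "a \<in> idempotents M \<Longrightarrow> a \<oplus> a = a"
  by (auto simp: idempotents_def)

lemma neg_is_min:
  assumes "a \<in> idempotents M" "x \<in> carrier M" "x \<preceq> a"
  shows "is_min M (emv_neg M a x) {z \<in> initial_segment M a. x \<oplus> z = a}"
proof -
  obtain z where z: "is_min M z {z \<in> initial_segment M a. x \<oplus> z = a}"
    using neg_exists assms by (auto simp: initial_segment_def)
  show ?thesis unfolding emv_neg_def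
    by (rule theI[where P = "\<lambda>z. is_min M z {z \<in> initial_segment M a. x \<oplus> z = a}", OF z])
      (use z in \<open>auto simp: is_min_def initial_segment_def intro!: le_antisym\<close>)
qed

lemma neg_props:
  assumes "a \<in> idempotents M" "x \<in> carrier M" "x \<preceq> a"
  shows neg_closed: "emv_neg M a x \<in> carrier M"
    and neg_le: "emv_neg M a x \<preceq> a"
    and oplus_neg: "x \<oplus> emv_neg M a x = a"
    and neg_neg: "emv_neg M a (emv_neg M a x) = x"
    and neg_least: "\<lbrakk>z \<in> carrier M; z \<preceq> a; x \<oplus> z = a\<rbrakk> \<Longrightarrow> emv_neg M a x \<preceq> z"
  using neg_is_min[OF assms] mv_algebra.neg_neg[OF segment_mv[OF assms(1)]] assms
  by (auto simp: is_min_def initial_segment_def)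

lemma neg_antimono:
  assumes a: "a \<in> idempotents M" and x: "x \<in> carrier M" and y: "y \<in> carrier M" "y \<preceq> a"
    and le: "x \<preceq> y"
  shows "emv_neg M a y \<preceq> emv_neg M a x"
proof -
  note ac = idemD[OF a]
  have xa: "x \<preceq> a" using le_trans x y ac le by blast
  note nx = neg_props[OF a x xa]
  have "y \<oplus> emv_neg M a x \<preceq> a \<oplus> a" using oplus_mono2 y nx ac by blast
  moreover have "a \<preceq> y \<oplus> emv_neg M a x"
    using oplus_mono2[of x "emv_neg M a x" y "emv_neg M a x"] x y nx le le_refl by simp
  ultimately have "y \<oplus> emv_neg M a x = a" using le_antisym y nx ac oplus_closed by simp
  then show ?thesis using neg_props(5)[OF a y] nx by blast
qed

lemma lukasiewicz:
  assumes "a \<in> idempotents M" "x \<in> carrier M" "x \<preceq> a" "y \<in> carrier M" "y \<preceq> a"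
  shows "x \<oplus> emv_neg M a (x \<oplus> emv_neg M a y) = y \<oplus> emv_neg M a (y \<oplus> emv_neg M a x)"
  using mv_algebra.lukasiewicz[OF segment_mv[OF assms(1)]] assms
  by (auto simp: initial_segment_def)

lemma neg_top: "a \<in> idempotents M \<Longrightarrow> emv_neg M a a = \<zero>"
  using neg_props(5)[of a a \<zero>] neg_props(1)[of a a]
  by (simp add: idemD le_refl zero_le zero_closed le_antisym)

lemma oplus_bounded:
  assumes "a \<in> idempotents M" "x \<in> carrier M" "x \<preceq> a" "y \<in> carrier M" "y \<preceq> a"
  shows "x \<oplus> y \<preceq> a"
  using oplus_mono2[of x y a a] assms idemD by force

lemma idem_oplus_closed:
  assumes a: "a \<in> idempotents M" and b: "b \<in> idempotents M"
  shows "a \<oplus> b \<in> idempotents M"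
proof -
  note c = idemD[OF a] idemD[OF b]
  have "(a \<oplus> b) \<oplus> (a \<oplus> b) = (a \<oplus> a) \<oplus> (b \<oplus> b)"
    using c(1,3) by (metis plus.m_assoc plus.m_comm oplus_closed)
  then show ?thesis using c by (simp add: idempotents_def)
qed

lemma idem_oplus_of_le:
  assumes a: "a \<in> idempotents M" and m: "m \<in> carrier M" "a \<preceq> m"
  shows "a \<oplus> m = m"
proof -
  obtain c where c: "c \<in> idempotents M" "m \<preceq> c" using idempotent_above m by blast
  note cc = idemD[OF c(1)] and ac = idemD[OF a]
  have a_c: "a \<preceq> c" using le_trans ac cc c m by blast
  note na = neg_props[OF c(1) ac(1) a_c] and nm = neg_props[OF c(1) m(1) c(2)]
  define t where "t = emv_neg M c (a \<oplus> emv_neg M c m)"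
  have t: "t \<in> carrier M"
    unfolding t_def using neg_props(1)[OF c(1)] oplus_bounded[OF c(1)] ac a_c nm by simp
  have "c \<preceq> m \<oplus> emv_neg M c a"
    using oplus_mono2[of a "emv_neg M c a" m "emv_neg M c a"] ac m na le_refl by simp
  then have "m \<oplus> emv_neg M c a = c"
    using oplus_bounded[OF c(1) m(1) c(2), of "emv_neg M c a"] na m cc le_antisym by simp
  then have "m = a \<oplus> t"
    unfolding t_def lukasiewicz[OF c(1) ac(1) a_c m(1) c(2)] by (simp add: neg_top c m)
  then show ?thesis using ac t by (metis plus.m_assoc)
qed

lemma idem_oplus_eq_vee:
  assumes a: "a \<in> idempotents M" and b: "b \<in> carrier M"
  shows "a \<oplus> b = a \<curlyvee> b"
proof (rule le_antisym)
  note ac = idemD[OF a]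
  show cl: "a \<oplus> b \<in> carrier M" "a \<curlyvee> b \<in> carrier M"
    using ac b oplus_closed vee_closed by auto
  show "a \<curlyvee> b \<preceq> a \<oplus> b" using vee_least cl ac b le_oplus1 le_oplus2 by simp
  have "a \<oplus> b \<preceq> a \<oplus> (a \<curlyvee> b)" using oplus_mono2 ac b cl le_refl le_vee2 by simp
  then show "a \<oplus> b \<preceq> a \<curlyvee> b" using idem_oplus_of_le[OF a cl(2)] le_vee1 ac b by simp
qed

lemma idem_vee_closed: "\<lbrakk>a \<in> idempotents M; b \<in> idempotents M\<rbrakk> \<Longrightarrow> a \<curlyvee> b \<in> idempotents M"
  using idem_oplus_closed idem_oplus_eq_vee idemD(1) by metis

lemma idem_wedge_closed:
  assumes a: "a \<in> idempotents M" and b: "b \<in> idempotents M"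
  shows "a \<curlywedge> b \<in> idempotents M"
proof -
  note c = idemD[OF a] idemD[OF b]
  let ?m = "a \<curlywedge> b"
  have m: "?m \<in> carrier M" "?m \<preceq> a" "?m \<preceq> b" using c wedge_closed wedge_le1 wedge_le2 by auto
  have "?m \<oplus> ?m \<preceq> ?m"
    using wedge_greatest oplus_bounded[OF a] oplus_bounded[OF b] m c oplus_closed by simp
  then show ?thesis
    using le_antisym le_oplus1[of ?m ?m] m oplus_closed by (simp add: idempotents_def)
qed

lemma idem_neg:
  assumes a: "a \<in> idempotents M" and x: "x \<in> idempotents M" "x \<preceq> a"
  shows idem_vee_neg: "x \<curlyvee> emv_neg M a x = a"
    and idem_wedge_neg: "x \<curlywedge> emv_neg M a x = \<zero>"
    and idem_neg_closed: "emv_neg M a x \<in> idempotents M"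
proof -
  note ac = idemD[OF a] and xc = idemD[OF x(1)]
  let ?x = "emv_neg M a x"
  note nx = neg_props[OF a xc(1) x(2)]
  show v: "x \<curlyvee> ?x = a" using idem_oplus_eq_vee[OF x(1) nx(1)] nx by simp
  let ?y = "x \<curlywedge> ?x"
  have y: "?y \<in> carrier M" "?y \<preceq> x" "?y \<preceq> ?x"
    using xc nx wedge_closed wedge_le1 wedge_le2 by auto
  have ya: "?y \<preceq> a" using le_trans[OF y(1) xc(1) ac(1)] y x by simp
  note ny = neg_props[OF a y(1) ya]
  have "?x \<preceq> emv_neg M a ?y" using neg_antimono[OF a y(1) xc(1) x(2) y(2)] .
  moreover have "x \<preceq> emv_neg M a ?y" using neg_antimono[OF a y(1) nx(1,2) y(3)] nx by simp
  ultimately have "a \<preceq> emv_neg M a ?y" using vee_least[OF xc(1) nx(1) ny(1)] v by simp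
  then have "emv_neg M a ?y = a" using le_antisym ny ac by blast
  then show "?y = \<zero>" using ny(4) neg_top[OF a] by simp
  have xx: "?x \<oplus> ?x \<in> carrier M" "?x \<oplus> ?x \<preceq> a"
    using nx oplus_closed oplus_bounded[OF a] by auto
  note nxx = neg_props[OF a xx]
  have "?x \<oplus> emv_neg M a (?x \<oplus> ?x) = x \<oplus> emv_neg M a (x \<oplus> emv_neg M a ?x)"
    using lukasiewicz[OF a nx(1,2) xc(1) x(2)] by simp
  also have "\<dots> = a" using nx xc by simp
  finally have "x \<preceq> emv_neg M a (?x \<oplus> ?x)" using neg_props(5)[OF a nx(1,2) nxx(1,2)] nx by simp
  then have "?x \<oplus> ?x \<preceq> ?x" using neg_antimono[OF a xc(1) nxx(1,2)] nxx by simp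
  then show "?x \<in> idempotents M"
    using le_antisym le_oplus1[of ?x ?x] xx nx by (simp add: idempotents_def)
qed

theorem idempotent_algebra_generalized_boolean: "is_generalized_boolean (idempotent_algebra M)"
proof -
  let ?I = "idempotent_algebra M"
  have [simp]: "carrier ?I = idempotents M" "vee ?I = vee M" "wedge ?I = wedge M"
    "oplus ?I = oplus M" "zero ?I = \<zero>" "emv_le ?I = emv_le M"
    by (auto simp: idempotent_algebra_def emv_le_def fun_eq_iff)
  have "\<zero> \<in> idempotents M" by (simp add: idempotents_def zero_closed)
  then have dl: "distrib_lattice_zero ?I"
    by unfold_locales
      (auto simp: idemD idem_vee_closed idem_wedge_closed vee_assoc wedge_assoc vee_absorb
        wedge_absorb wedge_vee_distrib zero_le intro: vee_comm wedge_comm)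
  have "\<exists>y\<in>idempotents M. x \<curlywedge> y = a \<and> x \<curlyvee> y = b"
    if a: "a \<in> idempotents M" and b: "b \<in> idempotents M" and x: "x \<in> idempotents M"
      and le: "a \<preceq> x" "x \<preceq> b" for a b x
  proof
    let ?n = "emv_neg M b x"
    note n = idem_neg[OF b x le(2)]
    note c = idemD(1)[OF a] idemD(1)[OF b] idemD(1)[OF x] idemD(1)[OF n(3)]
    show "a \<curlyvee> ?n \<in> idempotents M" using idem_vee_closed a n by blast
    have "x \<curlywedge> (a \<curlyvee> ?n) = (x \<curlywedge> a) \<curlyvee> \<zero>" using wedge_vee_distrib c n by simp
    also have "x \<curlywedge> a = a" using le wedge_comm c by (simp add: emv_le_def)
    also have "a \<curlyvee> \<zero> = a" using vee_of_le[of \<zero> a] vee_comm zero_le zero_closed c by metis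
    finally have 1: "x \<curlywedge> (a \<curlyvee> ?n) = a" .
    have "x \<curlyvee> (a \<curlyvee> ?n) = (a \<curlyvee> x) \<curlyvee> ?n" using vee_assoc vee_comm c by metis
    then have "x \<curlyvee> (a \<curlyvee> ?n) = b" using vee_of_le c le n by simp
    with 1 show "x \<curlywedge> (a \<curlyvee> ?n) = a \<and> x \<curlyvee> (a \<curlyvee> ?n) = b" ..
  qed
  then have "gen_boolean_lattice ?I"
    using dl by (simp add: gen_boolean_lattice_def gen_boolean_lattice_axioms_def)
  then show ?thesis by (simp add: is_generalized_boolean_def idem_oplus_eq_vee idemD)
qed

theorem is_generalized_boolean_iff:
  "is_generalized_boolean M \<longleftrightarrow> (\<forall>x\<in>carrier M. \<forall>y\<in>carrier M. x \<oplus> y = x \<curlyvee> y)"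
proof
  assume *: "\<forall>x\<in>carrier M. \<forall>y\<in>carrier M. x \<oplus> y = x \<curlyvee> y"
  have "idempotents M = carrier M"
    using * vee_of_le le_refl by (auto simp: idempotents_def)
  then have "idempotent_algebra M = M" by (simp add: idempotent_algebra_def)
  then show "is_generalized_boolean M" using idempotent_algebra_generalized_boolean by simp
qed (simp add: is_generalized_boolean_def)

lemma neg_change:
  assumes a: "a \<in> idempotents M" and b: "b \<in> idempotents M" "a \<preceq> b"
    and x: "x \<in> carrier M" "x \<preceq> a"
  shows "emv_neg M b x = emv_neg M a x \<oplus> emv_neg M b a"
proof -
  note ac = idemD[OF a] and bc = idemD[OF b(1)]
  have xb: "x \<preceq> b" using le_trans x ac bc b by blast
  let ?u = "emv_neg M b x" and ?a = "emv_neg M b a" and ?p = "emv_neg M a x"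
  note u = neg_props[OF b(1) x(1) xb] and na = idem_neg[OF b(1) a b(2)]
    and nb = neg_props[OF b(1) ac(1) b(2)] and p = neg_props[OF a x]
  have pb: "?p \<preceq> b" using le_trans p ac bc b by blast
  show ?thesis
  proof (rule le_antisym)
    show cl: "?u \<in> carrier M" "?p \<oplus> ?a \<in> carrier M" using u p nb oplus_closed by auto
    have "x \<oplus> (?p \<oplus> ?a) = b" using p nb x plus.m_assoc by metis
    then show "?u \<preceq> ?p \<oplus> ?a"
      using neg_props(5)[OF b(1) x(1) xb cl(2)] oplus_bounded[OF b(1)] p pb nb by simp
    let ?w = "?u \<curlywedge> a"
    have w: "?w \<in> carrier M" "?w \<preceq> a" "?w \<preceq> ?u"
      using u ac wedge_closed wedge_le1 wedge_le2 by auto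
    have "?u = ?u \<curlywedge> (a \<curlyvee> ?a)" using na u by (simp add: emv_le_def)
    also have "\<dots> = ?w \<curlyvee> (?u \<curlywedge> ?a)" using wedge_vee_distrib u ac nb by simp
    finally have ueq: "?u = ?w \<curlyvee> (?u \<curlywedge> ?a)" .
    have ua: "?u \<curlywedge> ?a \<in> carrier M" "?u \<curlywedge> ?a \<preceq> ?a"
      using u nb wedge_closed wedge_le2 by auto
    have wa: "?w \<oplus> ?a \<in> carrier M" using w nb oplus_closed by auto
    have "?u \<curlywedge> ?a \<preceq> ?w \<oplus> ?a" using le_trans[OF ua(1) nb(1) wa ua(2)] le_oplus2 w nb by simp
    then have "?u \<preceq> ?w \<oplus> ?a"
      using vee_least[OF w(1) ua(1) wa] le_oplus1[OF w(1) nb(1)] ueq by simp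
    then have "b \<preceq> x \<oplus> (?w \<oplus> ?a)"
      using oplus_mono2[OF x(1) u(1) x(1) wa] le_refl x u by simp
    moreover have "x \<oplus> (?w \<oplus> ?a) = ?a \<oplus> (x \<oplus> ?w)"
      using x w nb plus.m_assoc plus.m_comm oplus_closed by metis
    moreover have v: "x \<oplus> ?w \<in> carrier M" "x \<oplus> ?w \<preceq> a" using x w oplus_closed oplus_bounded[OF a] by auto
    moreover have vb: "x \<oplus> ?w \<preceq> b" using le_trans v ac bc b by blast
    ultimately have "?a \<oplus> (x \<oplus> ?w) = b"
      using oplus_bounded[OF b(1) nb(1,2) v(1) vb] le_antisym bc nb oplus_closed by simp
    then have "a \<preceq> x \<oplus> ?w" using neg_props(5)[OF b(1) nb(1,2) v(1) vb] nb by simp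
    then have "x \<oplus> ?w = a" using le_antisym v ac by blast
    then have "?p \<preceq> ?w" using neg_props(5)[OF a x w(1,2)] by simp
    then have "?p \<preceq> ?u" using le_trans p w u by blast
    moreover have "?a \<preceq> ?u" using neg_antimono[OF b(1) x(1) ac(1) b(2) x(2)] .
    ultimately have "?a \<curlyvee> ?p \<preceq> ?u" using vee_least p nb u by simp
    then show "?p \<oplus> ?a \<preceq> ?u"
      using idem_oplus_eq_vee[OF na(3) p(1)] plus.m_comm p nb by simp
  qed
qed

lemma odot_at_mono:
  assumes a: "a \<in> idempotents M" and b: "b \<in> idempotents M" "a \<preceq> b"
    and x: "x \<in> carrier M" "x \<preceq> a" and y: "y \<in> carrier M" "y \<preceq> a"
  shows "emv_odot_at M b x y = emv_odot_at M a x y"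
proof -
  let ?a = "emv_neg M b a" and ?p = "emv_neg M a x" and ?q = "emv_neg M a y"
  note ac = idemD[OF a] and bc = idemD[OF b(1)]
  note p = neg_props[OF a x] and q = neg_props[OF a y]
    and na = idem_neg[OF b(1) a b(2)] and nb = neg_props[OF b(1) ac(1) b(2)]
  have w: "?p \<oplus> ?q \<in> carrier M" "?p \<oplus> ?q \<preceq> a" using p q oplus_closed oplus_bounded[OF a] by auto
  note nw = neg_props[OF a w]
  have nwb: "emv_neg M a (?p \<oplus> ?q) \<preceq> b" using le_trans nw ac bc b by blast
  have "(?p \<oplus> ?a) \<oplus> (?q \<oplus> ?a) = (?p \<oplus> ?q) \<oplus> (?a \<oplus> ?a)"
    using p(1) q(1) nb(1) by (metis plus.m_assoc plus.m_comm oplus_closed)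
  also have "\<dots> = emv_neg M b (emv_neg M a (?p \<oplus> ?q))"
    using neg_change[OF a b nw(1,2)] nw idemD[OF na(3)] by simp
  finally show ?thesis
    unfolding emv_odot_at_def neg_change[OF a b x] neg_change[OF a b y]
    using neg_props(4)[OF b(1) nw(1) nwb] by simp
qed

theorem emv_odot_eq:
  assumes a: "a \<in> idempotents M"
    and x: "x \<in> carrier M" "x \<preceq> a" and y: "y \<in> carrier M" "y \<preceq> a"
  shows "x \<odot> y = emv_neg M a (emv_neg M a x \<oplus> emv_neg M a y)"
proof -
  define b where "b = (SOME b. b \<in> idempotents M \<and> x \<preceq> b \<and> y \<preceq> b)"
  have b: "b \<in> idempotents M" "x \<preceq> b" "y \<preceq> b"
    unfolding b_def using someI_ex[of "\<lambda>b. b \<in> idempotents M \<and> x \<preceq> b \<and> y \<preceq> b"] a x y by blast+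
  note c = idem_oplus_closed[OF a b(1)]
  have "emv_odot_at M b x y = emv_odot_at M (a \<oplus> b) x y"
    using odot_at_mono[OF b(1) c] le_oplus2 idemD(1)[OF a] idemD(1)[OF b(1)] x y b by simp
  also have "\<dots> = emv_odot_at M a x y"
    using odot_at_mono[OF a c] le_oplus1 idemD(1)[OF a] idemD(1)[OF b(1)] x y by simp
  finally show ?thesis by (simp add: emv_odot_def b_def[symmetric] emv_odot_at_def)
qed

end

end

theory Submission
  imports Defs
begin

text \<open>An idempotent \<open>e\<close> satisfies \<open>e \<odot> e = e\<close>, so \<open>r 0 = r 0 \<odot> r 0 = 0\<close> as soon as \<open>r 0\<close> is
  idempotent. Conversely, if \<open>r 0 = 0\<close> then \<open>t \<odot> t = 0\<close> forces \<open>t = 0\<close>. For \<open>x \<le> a\<close> with \<open>a\<close>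
  idempotent, \<open>t = (x \<oplus> x) \<odot> \<lambda>\<^sub>a(x)\<close> has \<open>t \<odot> t = 0\<close> and \<open>x \<oplus> t = x \<oplus> x\<close>, hence \<open>x\<close> is
  idempotent.\<close>

context emv_algebra
begin

lemma zero_idem: "\<zero> \<in> idempotents M"
  by (simp add: idempotents_def zero_closed)

text \<open>Take \<open>x\<close> itself as the bounding idempotent: there the complement of
  \<open>x\<close> is \<open>\<zero>\<close>, and that of \<open>\<zero>\<close> is
  \<open>x\<close>.\<close>

lemma idem_odot_self:
  assumes "x \<in> idempotents M"
  shows "x \<odot> x = x"
proof -
  note xc = idemD[OF assms]
  have "emv_neg M x \<zero> = x"
    using neg_props(4)[OF assms xc(1)] neg_top[OF assms] le_refl xc by simp
  then show ?thesis
    using emv_odot_eq[OF assms xc(1) _ xc(1)] neg_top[OF assms] le_refl xc zero_closed by simp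
qed

lemma odot_self_eq_zero:
  assumes a: "a \<in> idempotents M" and t: "t \<in> carrier M" "t \<preceq> a"
    and "emv_neg M a t \<oplus> emv_neg M a t = a"
  shows "t \<odot> t = \<zero>"
  using emv_odot_eq[OF a t t] assms by (simp add: neg_top)

lemma oplus_self_decomposition:
  assumes x: "x \<in> carrier M"
  obtains t where "t \<in> carrier M" "t \<odot> t = \<zero>" "x \<oplus> t = x \<oplus> x"
proof -
  obtain a where a: "a \<in> idempotents M" and xa: "x \<preceq> a"
    using idempotent_above x by blast
  note ac = idemD[OF a] and nx = neg_props[OF a x xa]
  define d where "d = x \<oplus> x"
  have d: "d \<in> carrier M" "d \<preceq> a"
    unfolding d_def using oplus_bounded[OF a] x xa oplus_closed by auto
  note nd = neg_props[OF a d]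
  \<comment> \<open>The complement of \<open>u\<close> in [0,a] is the truncated difference of
    \<open>d\<close> and \<open>x\<close>; it serves as the witness \<open>t\<close>.\<close>
  define u where "u = x \<oplus> emv_neg M a d"
  have u: "u \<in> carrier M" "u \<preceq> a"
    unfolding u_def using oplus_bounded[OF a] x xa nd oplus_closed by auto
  note nu = neg_props[OF a u]
  have absorb: "a \<oplus> z = a" if "z \<in> carrier M" "z \<preceq> a" for z
    using that le_antisym oplus_bounded[OF a ac(1)] le_oplus1 le_refl ac oplus_closed by simp
  \<comment> \<open>Regrouping puts the two copies of \<open>x\<close> together as \<open>d\<close>,
    which meets its own complement; \<open>a\<close> absorbs the rest.\<close>
  have "u \<oplus> u = (d \<oplus> emv_neg M a d) \<oplus> emv_neg M a d"
    unfolding u_def d_def using x nd(1)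
    by (metis d_def plus.m_assoc plus.m_comm oplus_closed)
  also have "\<dots> = a" using nd absorb by simp
  finally have "emv_neg M a u \<odot> emv_neg M a u = \<zero>"
    using odot_self_eq_zero[OF a nu(1,2)] nu by simp
  \<comment> \<open>The Lukasiewicz axiom swaps \<open>x\<close> and \<open>d\<close>. Since
    \<open>d \<oplus> emv_neg M a x\<close> is \<open>a\<close>, whose complement is
    \<open>\<zero>\<close>, just \<open>d\<close> remains.\<close>
  moreover have "x \<oplus> emv_neg M a u = d"
  proof -
    have "d \<oplus> emv_neg M a x = (x \<oplus> emv_neg M a x) \<oplus> x"
      unfolding d_def using x nx(1) by (metis plus.m_assoc plus.m_comm oplus_closed)
    also have "\<dots> = a" using nx absorb x xa by simp
    finally show ?thesis
      unfolding u_def lukasiewicz[OF a x xa d] using neg_top[OF a] d by simp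
  qed
  ultimately show thesis using that nu unfolding d_def by blast
qed

lemma idempotent_if_no_nilpotents:
  assumes nil: "\<And>t. t \<in> carrier M \<Longrightarrow> t \<odot> t = \<zero> \<Longrightarrow> t = \<zero>"
  shows "idempotents M = carrier M"
proof -
  have "x \<oplus> x = x" if x: "x \<in> carrier M" for x
    using oplus_self_decomposition[OF x] nil x by (metis plus.r_one)
  then show ?thesis by (auto simp: idempotents_def)
qed

lemma is_generalized_boolean_iff_idempotents:
  "is_generalized_boolean M \<longleftrightarrow> idempotents M = carrier M"
proof
  assume "is_generalized_boolean M"
  then show "idempotents M = carrier M"
    using vee_of_le le_refl by (auto simp: is_generalized_boolean_iff idempotents_def)
next
  assume "idempotents M = carrier M"
  then show "is_generalized_boolean M"
    by (simp add: is_generalized_boolean_iff idem_oplus_eq_vee)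
qed

lemma square_root_zero_iff:
  assumes "square_root M r"
  shows "r \<zero> = \<zero> \<longleftrightarrow> idempotents M = carrier M"
    and "r \<zero> = \<zero> \<longleftrightarrow> r \<zero> \<in> idempotents M"
proof -
  have rc: "r \<zero> \<in> carrier M" and rr: "r \<zero> \<odot> r \<zero> = \<zero>"
    using assms zero_closed by (auto simp: square_root_def)
  \<comment> \<open>By (Sq2) at \<open>\<zero>\<close>, \<open>r \<zero>\<close> bounds every
    element whose \<odot>-square is \<open>\<zero>\<close>.\<close>
  have max: "y \<preceq> r \<zero>" if "y \<in> carrier M" "y \<odot> y \<preceq> \<zero>" for y
    using assms that zero_closed by (auto simp: square_root_def)
  show idem: "r \<zero> = \<zero> \<longleftrightarrow> r \<zero> \<in> idempotents M"
    using idem_odot_self rr zero_idem by metis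
  have "idempotents M = carrier M" if "r \<zero> = \<zero>"
    using idempotent_if_no_nilpotents max that le_antisym zero_le zero_closed le_refl by metis
  then show "r \<zero> = \<zero> \<longleftrightarrow> idempotents M = carrier M"
    using idem rc by auto
qed

end

text \<open>All conditions evaluate the map on the carrier only, where restriction changes
  nothing.\<close>

lemma square_root_restrict: "square_root M (restrict r (carrier M)) \<longleftrightarrow> square_root M r"
  by (auto simp: square_root_def Pi_iff)

theorem theorem3p6:
  fixes M :: "('a, 'm) emv_scheme" (structure) and r :: "'a \<Rightarrow> 'a"
  assumes "emv_algebra M" and "square_root M r"
  shows "(is_generalized_boolean M \<longleftrightarrow> r \<zero> = \<zero>) \<and>
    (square_root (idempotent_algebra M) (restrict r (idempotents M)) \<longleftrightarrow> r \<zero> = \<zero>)"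
proof -
  interpret emv_algebra M by fact
  note zero_iff = square_root_zero_iff[OF assms(2)]
  have "square_root (idempotent_algebra M) (restrict r (idempotents M))" if "r \<zero> = \<zero>"
  proof -
    have I: "idempotents M = carrier M" using that zero_iff by blast
    then have "idempotent_algebra M = M" by (simp add: idempotent_algebra_def)
    then show ?thesis using I assms(2) by (simp add: square_root_restrict)
  qed
  \<comment> \<open>A square root on the idempotents maps into them, in particular at
    \<open>\<zero>\<close>.\<close>
  moreover have "r \<zero> \<in> idempotents M"
    if "square_root (idempotent_algebra M) (restrict r (idempotents M))"
    using that zero_idem by (auto simp: square_root_def idempotent_algebra_def Pi_iff)
  ultimately show ?thesis
    using zero_iff is_generalized_boolean_iff_idempotents by blast
qed

end
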